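(* For every integer $n\geq 1$, $$F_{n}(y,t)=(1+yt)(1+yt^{2})^{n-1}\,P_{n}^{(\mathrm{lpk},\mathrm{val},\mathrm{des})}\left(\frac{t(1+y)(y+t)}{(y+t^{2})(1+yt)},\frac{t(1+y)(1+yt)}{(1+yt^{2})(y+t)},\frac{y+t^{2}}{1+yt^{2}}\right).$$
   Context: $\mathfrak{S}_n$ is the set of permutations $\pi=\pi_1\cdots\pi_n$ of $[n]=\{1,\dots,n\}$. For $\pi\in\mathfrak{S}_n$: $\mathrm{des}(\pi)$ is the number of $i\in[n-1]$ with $\pi_i>\pi_{i+1}$; $\mathrm{lpk}(\pi)$ is the number of left peaks, where $i\in[n-1]$ is a left peak if either $2\le i\le n-1$ and $\pi_{i-1}<\pi_i>\pi_{i+1}$, or $i=1$ and $\pi_1>\pi_2$; $\mathrm{val}(\pi)$ is the number of valleys, i.e. of $i$ with $2\le i\le n-1$ and $\pi_{i-1}>\pi_i<\pi_{i+1}$. $P_n^{(\mathrm{lpk},\mathrm{val},\mathrm{des})}(y,z,t)=\sum_{\pi\in\mathfrak{S}_n}y^{\mathrm{lpk}(\pi)}z^{\mathrm{val}(\pi)}t^{\mathrm{des}(\pi)}$ for $n\ge1$. $\mathfrak{B}_n$ is the set of signed permutations: permutations $\pi$ of $\{-n,\dots,-1,0,1,\dots,n\}$ with $\pi_{-i}=-\pi_i$ for all $i$ (so $\pi_0=0$), written $\pi=\pi_1\cdots\pi_n$. For $\pi\in\mathfrak{B}_n$: $\mathrm{des}_B(\pi)$ is the number of $i\in\{0,1,\dots,n-1\}$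 with $\pi_i>\pi_{i+1}$ (where $\pi_0=0$); the flag descent number $\mathrm{fdes}(\pi)$ is $2\,\mathrm{des}_B(\pi)$ if $\pi_1>0$ and $2\,\mathrm{des}_B(\pi)-1$ if $\pi_1<0$; $\mathrm{neg}(\pi)$ is the number of $i\in[n]$ with $\pi_i<0$. $F_n(y,t)=\sum_{\pi\in\mathfrak{B}_n}y^{\mathrm{neg}(\pi)}t^{\mathrm{fdes}(\pi)}$ for $n\ge1$. The identity is one of rational functions in the indeterminates $y,t$. *)

theory Defs
  imports
    "HOL-Computational_Algebra.Computational_Algebra"
    "HOL-Combinatorics.Permutations"
begin

text \<open>
  A permutation of \<open>[n]\<close> is a function \<open>nat \<Rightarrow> nat\<close> that permutes \<open>{1..n}\<close>; its values
  outside \<open>{1..n}\<close> are irrelevant to the statistics below.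
\<close>

definition sym_perms :: "nat \<Rightarrow> (nat \<Rightarrow> nat) set" where
  "sym_perms n = {p. p permutes {1..n}}"

definition des :: "nat \<Rightarrow> (nat \<Rightarrow> nat) \<Rightarrow> nat" where
  "des n p = card {i. 1 \<le> i \<and> i < n \<and> p i > p (i + 1)}"

definition left_peak :: "nat \<Rightarrow> (nat \<Rightarrow> nat) \<Rightarrow> nat \<Rightarrow> bool" where
  "left_peak n p i \<longleftrightarrow>
     (2 \<le> i \<and> i < n \<and> p (i - 1) < p i \<and> p i > p (i + 1)) \<or>
     (i = 1 \<and> i < n \<and> p 1 > p 2)"

definition lpk :: "nat \<Rightarrow> (nat \<Rightarrow> nat) \<Rightarrow> nat" where
  "lpk n p = card {i. left_peak n p i}"

definition val :: "nat \<Rightarrow> (nat \<Rightarrow> nat) \<Rightarrow> nat" where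
  "val n p = card {i. 2 \<le> i \<and> i < n \<and> p (i - 1) > p i \<and> p i < p (i + 1)}"

definition P_lpk_val_des :: "nat \<Rightarrow> 'a::comm_semiring_1 \<Rightarrow> 'a \<Rightarrow> 'a \<Rightarrow> 'a" where
  "P_lpk_val_des n y z t = (\<Sum>p\<in>sym_perms n. y ^ lpk n p * z ^ val n p * t ^ des n p)"

definition signed_perms :: "nat \<Rightarrow> (int \<Rightarrow> int) set" where
  "signed_perms n = {p. p permutes {- int n..int n} \<and> (\<forall>i\<in>{- int n..int n}. p (- i) = - p i)}"

definition des_B :: "nat \<Rightarrow> (int \<Rightarrow> int) \<Rightarrow> nat" where
  "des_B n p = card {i. 0 \<le> i \<and> i < int n \<and> p i > p (i + 1)}"

text \<open>
  The subtraction in \<open>fdes\<close> does not truncate: for \<open>n \<ge> 1\<close>, if \<open>p 1 < 0 = p 0\<close>, then \<open>0\<close> is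
  a descent and \<open>des_B n p \<ge> 1\<close>.
\<close>

definition fdes :: "nat \<Rightarrow> (int \<Rightarrow> int) \<Rightarrow> nat" where
  "fdes n p = (if p 1 > 0 then 2 * des_B n p else 2 * des_B n p - 1)"

definition neg :: "nat \<Rightarrow> (int \<Rightarrow> int) \<Rightarrow> nat" where
  "neg n p = card {i. 1 \<le> i \<and> i \<le> int n \<and> p i < 0}"

definition F_neg_fdes :: "nat \<Rightarrow> 'a::comm_semiring_1 \<Rightarrow> 'a \<Rightarrow> 'a" where
  "F_neg_fdes n y t = (\<Sum>p\<in>signed_perms n. y ^ neg n p * t ^ fdes n p)"

text \<open>
  The field of rational functions in two indeterminates over the rationals is the fraction
  field of \<open>rat poly poly\<close>: the inner polynomial variable is \<open>y\<close>, the outer one is \<open>t\<close>.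
\<close>

type_synonym ratfun2 = "rat poly poly fract"

definition indet_y :: ratfun2 where
  "indet_y = to_fract [:[:0, 1:]:]"

definition indet_t :: ratfun2 where
  "indet_t = to_fract [:0, 1:]"

end

theory Submission
  imports Defs
begin

text \<open>
  Write a signed permutation as \<open>\<pi>\<^sub>i = \<plusminus>\<sigma>\<^sub>i\<close>. If \<open>\<sigma>\<^sub>i < \<sigma>\<^sub>i\<^sub>+\<^sub>1\<close>, then \<open>\<pi>\<close> has a descent at \<open>i\<close> iff
  \<open>\<pi>\<^sub>i\<^sub>+\<^sub>1 < 0\<close>; otherwise iff \<open>\<pi>\<^sub>i > 0\<close>. So for fixed \<open>\<sigma>\<close> every sign contributes its own factor, and the
  sum over all signs is a product over the positions: up to boundary terms, \<open>1 + y t\<^sup>2\<close> for a double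
  ascent, \<open>y + t\<^sup>2\<close> for a double descent, \<open>t\<^sup>2 (1 + y)\<close> for a peak and \<open>1 + y\<close> for a valley.
  The boundary terms fit the summand of \<open>P\<^sub>n\<close> at the reverse-complement of \<open>\<sigma>\<close>.
\<close>

section \<open>Sign weights of one permutation and its statistics\<close>

lemma des_Suc:
  assumes "n \<ge> 1"
  shows "des (Suc n) p = des n p + (if p n > p (Suc n) then 1 else 0)"
proof -
  have "{i. 1 \<le> i \<and> i < Suc n \<and> p i > p (i + 1)} =
      {i. 1 \<le> i \<and> i < n \<and> p i > p (i + 1)} \<union> (if p n > p (Suc n) then {n} else {})"
    using assms by (auto simp: less_Suc_eq)
  then show ?thesis
    unfolding des_def by auto
qed

lemma lpk_Suc:
  assumes "n \<ge> 1"
  shows "lpk (Suc n) p =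
    lpk n p + (if p n > p (Suc n) \<and> (n = 1 \<or> p (n - 1) < p n) then 1 else 0)"
proof -
  have "{i. left_peak (Suc n) p i} = {i. left_peak n p i} \<union>
      (if p n > p (Suc n) \<and> (n = 1 \<or> p (n - 1) < p n) then {n} else {})"
    using assms by (cases "n = 1") (auto simp: left_peak_def less_Suc_eq numeral_2_eq_2)
  moreover have "finite {i. left_peak n p i}"
    by (rule finite_subset[of _ "{..n}"]) (auto simp: left_peak_def)
  moreover have "n \<notin> {i. left_peak n p i}"
    by (simp add: left_peak_def)
  ultimately show ?thesis
    unfolding lpk_def by simp
qed

lemma val_Suc:
  assumes "n \<ge> 1"
  shows "val (Suc n) p =
    val n p + (if n \<ge> 2 \<and> p (n - 1) > p n \<and> p n < p (Suc n) then 1 else 0)"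
proof -
  have "{i. 2 \<le> i \<and> i < Suc n \<and> p (i - 1) > p i \<and> p i < p (i + 1)} =
      {i. 2 \<le> i \<and> i < n \<and> p (i - 1) > p i \<and> p i < p (i + 1)} \<union>
      (if n \<ge> 2 \<and> p (n - 1) > p n \<and> p n < p (Suc n) then {n} else {})"
    using assms by (auto simp: less_Suc_eq)
  then show ?thesis
    unfolding val_def by auto
qed

text \<open>Induction on \<open>n\<close>: appending an entry gives position \<open>n\<close> a
  right neighbour and creates a new last factor, while all earlier factors stay the same. The
  resulting quotient is \<open>1 + y * t ^ 2\<close> times the powers gained by the three
  statistics. Only distinct neighbours are assumed of \<open>p\<close>, because a prefix of a
  permutation need not permute an initial interval.\<close>

lemma prod_weights_eq_statistics:
  fixes y t :: "'a::field" and p :: "nat \<Rightarrow> nat"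
  assumes nz: "t \<noteq> 0" "y + t \<noteq> 0" "y + t ^ 2 \<noteq> 0" "1 + y * t \<noteq> 0" "1 + y * t ^ 2 \<noteq> 0"
    and "n \<ge> 1" and "\<And>i. 1 \<le> i \<Longrightarrow> i < n \<Longrightarrow> p i \<noteq> p (i + 1)"
  shows "(\<Prod>i\<in>{1..n}. (if 1 < i \<and> p i < p (i - 1) then t ^ 2 else 1) +
        y * (if i = n then t else if p i < p (i + 1) then t ^ 2 else 1)) =
    (1 + y * t) * (1 + y * t ^ 2) ^ (n - 1) *
    (((t * (1 + y) * (y + t)) / ((y + t ^ 2) * (1 + y * t))) ^ lpk n p *
     ((t * (1 + y) * (1 + y * t)) / ((1 + y * t ^ 2) * (y + t))) ^ val n p *
     ((y + t ^ 2) / (1 + y * t ^ 2)) ^ des n p)"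
    (is "prod (?f n) _ = _ * _ * (?Y ^ _ * ?Z ^ _ * ?T ^ _)")
  using assms(6,7)
proof (induction n rule: nat_induct_at_least)
  case base
  have "{i. left_peak 1 p i} = {}"
    "{i. 2 \<le> i \<and> i < 1 \<and> p (i - 1) > p i \<and> p i < p (i + 1)} = {}"
    "{i. 1 \<le> i \<and> i < 1 \<and> p i > p (i + 1)} = {}"
    by (auto simp: left_peak_def)
  then have "lpk 1 p = 0" "val 1 p = 0" "des 1 p = 0"
    unfolding lpk_def val_def des_def by (simp_all only: card.empty)
  then show ?case by simp
next
  case (Suc n)
  define Q where "Q = (\<Prod>i\<in>{1..<n}. ?f (Suc n) i)"
  define a where "a = (if 1 < n \<and> p n < p (n - 1) then t ^ 2 else 1)"
  define b where "b = (if p n < p (Suc n) then t ^ 2 else 1)"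
  define a' where "a' = (if p (Suc n) < p n then t ^ 2 else 1)"
  \<comment> \<open>\<open>r\<close> is the quotient of the right-hand sides for
    \<open>Suc n\<close> and \<open>n\<close>, read off from the recurrences of the
    statistics.\<close>
  define r where "r = (1 + y * t ^ 2) *
    ((if p n > p (Suc n) \<and> (n = 1 \<or> p (n - 1) < p n) then ?Y else 1) *
     (if n \<ge> 2 \<and> p (n - 1) > p n \<and> p n < p (Suc n) then ?Z else 1) *
     (if p n > p (Suc n) then ?T else 1))"
  let ?W = "\<lambda>n. (1 + y * t) * (1 + y * t ^ 2) ^ (n - 1) *
    (?Y ^ lpk n p * ?Z ^ val n p * ?T ^ des n p)"
  have n: "n \<ge> 1" by fact
  have "{1..n} = insert n {1..<n}" "{1..Suc n} = insert (Suc n) (insert n {1..<n})"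
    using n by auto
  moreover have "(\<Prod>i\<in>{1..<n}. ?f n i) = Q"
    unfolding Q_def by (rule prod.cong) auto
  ultimately have prods: "prod (?f n) {1..n} = (a + y * t) * Q"
      "prod (?f (Suc n)) {1..Suc n} = (a' + y * t) * ((a + y * b) * Q)"
    using n by (simp_all add: Q_def a_def b_def a'_def)
  have neq: "p n \<noteq> p (Suc n)" "n \<ge> 2 \<Longrightarrow> p (n - 1) \<noteq> p n"
    using Suc.prems[of n] Suc.prems[of "n - 1"] n by simp_all
  \<comment> \<open>This compares the two factors that change: as last position, \<open>n\<close>
    contributes \<open>a + y * t\<close>; afterwards it contributes \<open>a + y * b\<close>, and
    the new last position \<open>a' + y * t\<close>.\<close>
  have "(a' + y * t) * (a + y * b) = r * (a + y * t)"
  proof -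
    define A B C D where "A = 1 + y * t ^ 2" and "B = 1 + y * t" and "C = y + t" and "D = y + t ^ 2"
    have nz': "A \<noteq> 0" "B \<noteq> 0" "C \<noteq> 0" "D \<noteq> 0"
      using nz by (simp_all add: A_def B_def C_def D_def)
    have peak: "A * (t * (1 + y) * C / (D * B) * (D / A)) * B = t * C * (1 + y)"
      and double_descent: "A * (D / A) = D"
      and valley: "A * (t * (1 + y) * B / (A * C)) * (t * C) = B * (t ^ 2 * (1 + y))"
      using nz' by (simp_all add: power2_eq_square)
    \<comment> \<open>The unsimplified \<open>y * 1\<close> matches the term left by substituting
      \<open>b = 1\<close>.\<close>
    have sums: "t ^ 2 + y * t = t * C" "t ^ 2 + y * 1 = D" "t ^ 2 + y * t ^ 2 = t ^ 2 * (1 + y)"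
      by (simp_all add: C_def D_def algebra_simps power2_eq_square)
    note folds = A_def[symmetric] B_def[symmetric] C_def[symmetric] D_def[symmetric]
    \<comment> \<open>The letters record ascent or descent into and out of position
      \<open>n\<close>. The first position counts as entered by an ascent, which is the convention
      of left peaks.\<close>
    consider (aa) "n = 1 \<or> p (n - 1) < p n" "p n < p (Suc n)"
      | (ad) "n = 1 \<or> p (n - 1) < p n" "p (Suc n) < p n"
      | (da) "n \<ge> 2" "p n < p (n - 1)" "p n < p (Suc n)"
      | (dd) "n \<ge> 2" "p n < p (n - 1)" "p (Suc n) < p n"
      using n neq by fastforce
    then show ?thesis
    proof cases
      case aa
      then have "a = 1" "b = t ^ 2" "a' = 1" "r = A"
        by (auto simp: a_def b_def a'_def r_def A_def)
      then show ?thesis by (simp add: folds)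
    next
      case ad
      then have *: "a = 1" "b = 1" "a' = t ^ 2" "r = A * (?Y * ?T)"
        by (auto simp: a_def b_def a'_def r_def A_def)
      show ?thesis unfolding * folds sums using peak by simp
    next
      case da
      then have *: "a = t ^ 2" "b = t ^ 2" "a' = 1" "r = A * ?Z"
        by (auto simp: a_def b_def a'_def r_def A_def)
      show ?thesis unfolding * folds sums using valley by simp
    next
      case dd
      then have *: "a = t ^ 2" "b = 1" "a' = t ^ 2" "r = A * ?T"
        by (auto simp: a_def b_def a'_def r_def A_def)
      show ?thesis unfolding * folds sums double_descent by simp
    qed
  qed
  then have "prod (?f (Suc n)) {1..Suc n} = r * prod (?f n) {1..n}"
    unfolding prods by (simp add: mult_ac)
  also have "\<dots> = r * ?W n"
    using Suc.IH Suc.prems by simp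
  also have "\<dots> = ?W (Suc n)"
  proof -
    have "(1 + y * t ^ 2) ^ (Suc n - 1) = (1 + y * t ^ 2) * (1 + y * t ^ 2) ^ (n - 1)"
      using n by (cases n) auto
    then show ?thesis
      unfolding des_Suc[OF n] lpk_Suc[OF n] val_Suc[OF n] power_add r_def
      by (simp only: if_distrib[of "power _"] power_one_right power_0 mult_ac cong: if_cong)
  qed
  finally show ?case .
qed

section \<open>Signed permutations as permutations with a set of negative positions\<close>

text \<open>The factor \<open>sgn i\<close> makes the function odd on all integers. Where \<sigma>
  is the identity and \<open>N\<close> has no elements, it is the identity too, as
  \<open>permutes\<close> demands outside the interval.\<close>

definition apply_signs :: "(nat \<Rightarrow> nat) \<Rightarrow> nat set \<Rightarrow> int \<Rightarrow> int" where
  "apply_signs \<sigma> N i =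
    (if nat \<bar>i\<bar> \<in> N then - sgn i * int (\<sigma> (nat \<bar>i\<bar>)) else sgn i * int (\<sigma> (nat \<bar>i\<bar>)))"

lemma apply_signs_in_signed_perms:
  assumes "\<sigma> permutes {1..n}" "N \<subseteq> {1..n}"
  shows "apply_signs \<sigma> N \<in> signed_perms n"
proof -
  have abs: "\<bar>apply_signs \<sigma> N i\<bar> = int (\<sigma> (nat \<bar>i\<bar>))" for i
  proof (cases "i = 0")
    case True
    then show ?thesis
      using permutes_not_in[OF assms(1), of 0] by (simp add: apply_signs_def)
  qed (auto simp: apply_signs_def abs_mult)
  have odd: "apply_signs \<sigma> N (- i) = - apply_signs \<sigma> N i" for i
    by (simp add: apply_signs_def)
  have pos: "\<sigma> k > 0" if "k > 0" for k
    using permutes_in_image[OF assms(1), of k] permutes_not_in[OF assms(1), of k] that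
    by (cases "k \<in> {1..n}") auto
  have "inj_on (apply_signs \<sigma> N) {- int n..int n}"
  proof (rule inj_onI)
    fix i j assume eq: "apply_signs \<sigma> N i = apply_signs \<sigma> N j"
    then have "\<sigma> (nat \<bar>i\<bar>) = \<sigma> (nat \<bar>j\<bar>)"
      using abs[of i] abs[of j] by simp
    then have "nat \<bar>i\<bar> = nat \<bar>j\<bar>"
      using permutes_inj[OF assms(1)] by (simp add: inj_eq)
    then consider "i = j" | "i = - j" "j \<noteq> 0" by linarith
    then show "i = j"
    proof cases
      \<comment> \<open>Opposite arguments have opposite values, so equal values would have to be
        \<open>0\<close>; but the absolute value is a positive value of \<sigma>.\<close>
      case 2
      then have "apply_signs \<sigma> N j = 0" using eq odd[of j] by simp
      then show ?thesis using abs[of j] pos[of "nat \<bar>j\<bar>"] 2 by simp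
    qed
  qed
  moreover have "apply_signs \<sigma> N i \<in> {- int n..int n}" if "i \<in> {- int n..int n}" for i
  proof -
    have "\<sigma> (nat \<bar>i\<bar>) \<le> n"
      using that permutes_in_image[OF assms(1), of "nat \<bar>i\<bar>"] permutes_not_in[OF assms(1), of 0]
      by (cases "i = 0") auto
    then show ?thesis using abs[of i] by auto
  qed
  moreover have "apply_signs \<sigma> N i = i" if "i \<notin> {- int n..int n}" for i
  proof -
    have "nat \<bar>i\<bar> \<notin> {1..n}" using that by auto
    then show ?thesis
      using permutes_not_in[OF assms(1)] assms(2) that
      by (auto simp: apply_signs_def sgn_if)
  qed
  ultimately have "apply_signs \<sigma> N permutes {- int n..int n}"
    by (intro inj_imp_permutes) auto
  then show ?thesis
    using odd by (simp add: signed_perms_def)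
qed

text \<open>Equal absolute values at \<open>i\<close> and \<open>j\<close> mean
  \<open>p i = p j\<close> or \<open>p i = p (- j)\<close> by oddness, and for positive
  \<open>i\<close> and \<open>j\<close> injectivity leaves only \<open>i = j\<close>. The value
  \<open>0\<close> is already taken by the argument \<open>0\<close>.\<close>

lemma signed_perm_abs_permutes:
  assumes "p \<in> signed_perms n"
  shows "(\<lambda>i. nat \<bar>p (int i)\<bar>) permutes {1..n}"
proof -
  have p: "p permutes {- int n..int n}" and odd: "\<And>i. i \<in> {- int n..int n} \<Longrightarrow> p (- i) = - p i"
    using assms by (auto simp: signed_perms_def)
  have p0: "p 0 = 0" using odd[of 0] by simp
  have inj: "p i = p j \<longleftrightarrow> i = j" for i j
    using permutes_inj[OF p] by (simp add: inj_eq)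
  show ?thesis
  proof (rule inj_imp_permutes)
    show "inj_on (\<lambda>i. nat \<bar>p (int i)\<bar>) {1..n}"
    proof (rule inj_onI)
      fix i j assume ij: "i \<in> {1..n}" "j \<in> {1..n}" "nat \<bar>p (int i)\<bar> = nat \<bar>p (int j)\<bar>"
      then have "p (int i) = p (int j) \<or> p (int i) = p (- int j)"
        using odd[of "int j"] by auto
      then show "i = j" using ij inj by auto
    qed
    show "nat \<bar>p (int i)\<bar> \<in> {1..n}" if "i \<in> {1..n}" for i
      using that permutes_in_image[OF p, of "int i"] inj[of "int i" 0] p0 by auto
    show "nat \<bar>p (int i)\<bar> = i" if "i \<notin> {1..n}" for i
      using that permutes_not_in[OF p, of "int i"] p0 by (cases "i = 0") auto
  qed simp
qed

lemma apply_signs_of_signed_perm: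
  assumes "p \<in> signed_perms n"
  shows "apply_signs (\<lambda>i. nat \<bar>p (int i)\<bar>) {i \<in> {1..n}. p (int i) < 0} = p"
proof
  fix i
  have p: "p permutes {- int n..int n}" and odd: "\<And>i. i \<in> {- int n..int n} \<Longrightarrow> p (- i) = - p i"
    using assms by (auto simp: signed_perms_def)
  have p0: "p 0 = 0" using odd[of 0] by simp
  show "apply_signs (\<lambda>i. nat \<bar>p (int i)\<bar>) {i \<in> {1..n}. p (int i) < 0} i = p i"
  proof (cases "i \<in> {- int n..int n}")
    case True
    then show ?thesis
      using odd[of i] p0 by (cases "i > 0"; cases "i = 0") (auto simp: apply_signs_def sgn_if)
  next
    case False
    \<comment> \<open>Both signs are needed, since \<open>apply_signs\<close> evaluates
      \<open>p\<close> at the absolute value of \<open>i\<close>.\<close>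
    moreover from this have "p i = i" "p (- i) = - i"
      using permutes_not_in[OF p] by auto
    ultimately show ?thesis
      by (auto simp: apply_signs_def sgn_if abs_if)
  qed
qed

lemma sum_signed_perms:
  "(\<Sum>p\<in>signed_perms n. g p) =
   (\<Sum>\<sigma>\<in>sym_perms n. \<Sum>N\<in>Pow {1..n}. g (apply_signs \<sigma> N))"
proof -
  have "(\<Sum>p\<in>signed_perms n. g p) =
      (\<Sum>(\<sigma>, N)\<in>sym_perms n \<times> Pow {1..n}. g (apply_signs \<sigma> N))"
  proof (rule sum.reindex_bij_witness)
    fix p assume p: "p \<in> signed_perms n"
    let ?b = "(\<lambda>i. nat \<bar>p (int i)\<bar>, {i \<in> {1..n}. p (int i) < 0})"
    show "(\<lambda>(\<sigma>, N). apply_signs \<sigma> N) ?b = p"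
      using apply_signs_of_signed_perm[OF p] by simp
    show "?b \<in> sym_perms n \<times> Pow {1..n}"
      using signed_perm_abs_permutes[OF p] by (auto simp: sym_perms_def)
    show "(case ?b of (\<sigma>, N) \<Rightarrow> g (apply_signs \<sigma> N)) = g p"
      using apply_signs_of_signed_perm[OF p] by simp
  next
    fix b assume b: "b \<in> sym_perms n \<times> Pow {1..n}"
    obtain \<sigma> N where [simp]: "b = (\<sigma>, N)" by (cases b)
    have \<sigma>: "\<sigma> permutes {1..n}" and N: "N \<subseteq> {1..n}"
      using b by (auto simp: sym_perms_def)
    show "(\<lambda>(\<sigma>, N). apply_signs \<sigma> N) b \<in> signed_perms n"
      using apply_signs_in_signed_perms[OF \<sigma> N] by simp
    \<comment> \<open>\<sigma> has to be recovered as a function on all naturals, so the argument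
      \<open>0\<close> matters as well.\<close>
    have "\<sigma> 0 = 0" using permutes_not_in[OF \<sigma>, of 0] by simp
    then have "nat \<bar>apply_signs \<sigma> N (int i)\<bar> = \<sigma> i" for i
      by (cases "i = 0") (auto simp: apply_signs_def abs_mult)
    moreover have "apply_signs \<sigma> N (int i) < 0 \<longleftrightarrow> i \<in> N" if "i \<in> {1..n}" for i
      using that permutes_in_image[OF \<sigma>, of i] by (auto simp: apply_signs_def)
    ultimately show "(\<lambda>p. (\<lambda>i. nat \<bar>p (int i)\<bar>, {i \<in> {1..n}. p (int i) < 0}))
        ((\<lambda>(\<sigma>, N). apply_signs \<sigma> N) b) = b"
      using N by auto
  qed
  then show ?thesis by (simp add: sum.cartesian_product)
qed

section \<open>Negative entries and flag descents, position by position\<close>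

lemma neg_apply_signs:
  assumes "\<sigma> permutes {1..n}" "N \<subseteq> {1..n}"
  shows "neg n (apply_signs \<sigma> N) = card N"
proof -
  have "{i. 1 \<le> i \<and> i \<le> int n \<and> apply_signs \<sigma> N i < 0} = int ` N"
  proof (intro equalityI subsetI)
    fix i assume "i \<in> {i. 1 \<le> i \<and> i \<le> int n \<and> apply_signs \<sigma> N i < 0}"
    then have "i = int (nat i)" "nat i \<in> N"
      by (auto simp: apply_signs_def split: if_splits)
    then show "i \<in> int ` N" by blast
  next
    fix i assume "i \<in> int ` N"
    then obtain k where k: "i = int k" "k \<in> N" by auto
    then have "\<sigma> k > 0" "1 \<le> k" "k \<le> n"
      using assms(2) permutes_in_image[OF assms(1), of k] by auto
    with k show "i \<in> {i. 1 \<le> i \<and> i \<le> int n \<and> apply_signs \<sigma> N i < 0}"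
      by (auto simp: apply_signs_def)
  qed
  then show ?thesis unfolding neg_def by (simp add: card_image)
qed

text \<open>Every descent is charged to the single position whose sign decides it. If \<sigma>
  ascends from \<open>i\<close> to \<open>i + 1\<close>, there is a descent iff \<open>i + 1\<close>
  is negative; if \<sigma> descends there, iff \<open>i\<close> is positive. The descent at
  \<open>0\<close> occurs iff position \<open>1\<close> is negative, and it counts once instead of
  twice.\<close>

lemma fdes_apply_signs:
  assumes "n \<ge> 1" and \<sigma>: "\<sigma> permutes {1..n}" and N: "N \<subseteq> {1..n}"
  shows "fdes n (apply_signs \<sigma> N) =
    (\<Sum>i\<in>N. if i = 1 then 1 else if \<sigma> (i - 1) < \<sigma> i then 2 else 0) +
    (\<Sum>i\<in>{1..n} - N. if i < n \<and> \<sigma> (i + 1) < \<sigma> i then 2 else 0)"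
proof -
  let ?q = "apply_signs \<sigma> N"
  have pos: "\<sigma> i > 0" if "i \<in> {1..n}" for i
    using that permutes_in_image[OF \<sigma>, of i] by auto
  have val: "?q (int i) = (if i \<in> N then - int (\<sigma> i) else int (\<sigma> i))" if "i \<in> {1..n}" for i
    using that by (auto simp: apply_signs_def)
  have neq: "\<sigma> i \<noteq> \<sigma> (i + 1)" for i
    using permutes_inj[OF \<sigma>] by (simp add: inj_eq)
  let ?D1 = "{i \<in> N. i \<noteq> 1 \<and> \<sigma> (i - 1) < \<sigma> i}"
  let ?D2 = "{i \<in> {1..n} - N. i < n \<and> \<sigma> (i + 1) < \<sigma> i}"
  have fin: "finite N" using N finite_subset by blast
  have desc: "?q (int i) > ?q (int i + 1) \<longleftrightarrow>
      (if \<sigma> i < \<sigma> (i + 1) then i + 1 \<in> N else i \<notin> N)" if "1 \<le> i" "i < n" for i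
  proof -
    have "?q (int i + 1) = (if i + 1 \<in> N then - int (\<sigma> (i + 1)) else int (\<sigma> (i + 1)))"
      using val[of "i + 1"] that by (simp add: add.commute)
    then show ?thesis
      using val[of i] that pos[of i] pos[of "i + 1"] neq[of i] by auto
  qed
  have q0: "?q 0 = 0" by (simp add: apply_signs_def)
  have q1: "?q 1 = (if 1 \<in> N then - int (\<sigma> 1) else int (\<sigma> 1))"
    using val[of 1] assms(1) by simp
  have s1: "\<sigma> 1 > 0" using pos[of 1] assms(1) by simp
  \<comment> \<open>A position \<open>k\<close> in \<open>?D1\<close> is charged with the descent at
    \<open>k - 1\<close>, one in \<open>?D2\<close> with the descent at \<open>k\<close>
    itself.\<close>
  have "{i. 0 \<le> i \<and> i < int n \<and> ?q i > ?q (i + 1)} =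
      (if 1 \<in> N then {0} else {}) \<union> (\<lambda>i. int i - 1) ` ?D1 \<union> int ` ?D2"
  proof (intro equalityI subsetI)
    fix j assume "j \<in> {i. 0 \<le> i \<and> i < int n \<and> ?q i > ?q (i + 1)}"
    then have j: "0 \<le> j" "j < int n" "?q j > ?q (j + 1)" by auto
    then obtain i where i: "j = int i" by (metis nat_0_le)
    show "j \<in> (if 1 \<in> N then {0} else {}) \<union> (\<lambda>i. int i - 1) ` ?D1 \<union> int ` ?D2"
    proof (cases "i = 0")
      case True
      then show ?thesis using i j q0 q1 s1 by (auto split: if_splits)
    next
      case False
      then have *: "if \<sigma> i < \<sigma> (i + 1) then i + 1 \<in> N else i \<notin> N"
        using desc[of i] i j by auto
      show ?thesis
      proof (cases "\<sigma> i < \<sigma> (i + 1)")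
        case True
        then have "i + 1 \<in> ?D1" "j = int (i + 1) - 1" using * False i by auto
        then show ?thesis by blast
      next
        case nless: False
        then have "i \<in> ?D2" using * False i j neq[of i] by auto
        then show ?thesis using i by blast
      qed
    qed
  next
    fix j assume "j \<in> (if 1 \<in> N then {0} else {}) \<union> (\<lambda>i. int i - 1) ` ?D1 \<union> int ` ?D2"
    then consider "1 \<in> N" "j = 0" | k where "k \<in> ?D1" "j = int k - 1"
      | k where "k \<in> ?D2" "j = int k" by (auto split: if_splits)
    then show "j \<in> {i. 0 \<le> i \<and> i < int n \<and> ?q i > ?q (i + 1)}"
    proof cases
      case 1
      then show ?thesis using q0 q1 s1 assms(1) by auto
    next
      case 2
      then have k: "2 \<le> k" "k \<le> n" using N by force+
      then show ?thesis using desc[of "k - 1"] 2 by (auto simp: of_nat_diff)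
    next
      case 3
      then show ?thesis using desc[of k] by auto
    qed
  qed
  moreover have "card ((if 1 \<in> N then {0} else {}) \<union> (\<lambda>i. int i - 1) ` ?D1 \<union> int ` ?D2) =
      (if 1 \<in> N then 1 else 0) + card ?D1 + card ?D2"
  proof -
    \<comment> \<open>A common element \<open>l\<close> would make \<sigma> both ascend and descend
      from \<open>l\<close> to \<open>l + 1\<close>.\<close>
    have "((\<lambda>i. int i - 1) ` ?D1) \<inter> int ` ?D2 = {}"
    proof -
      have False if "k \<in> ?D1" "l \<in> ?D2" "int k - 1 = int l" for k l
      proof -
        have "k = l + 1" using that(3) by simp
        then show False using that(1,2) by auto
      qed
      then show ?thesis by blast
    qed
    moreover have "0 \<notin> (\<lambda>i. int i - 1) ` ?D1" "0 \<notin> int ` ?D2"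
      by auto
    moreover have "card ((\<lambda>i. int i - 1) ` ?D1) = card ?D1" "card (int ` ?D2) = card ?D2"
      by (auto intro!: card_image simp: inj_on_def)
    ultimately show ?thesis
      using fin by (simp add: card_Un_disjoint)
  qed
  ultimately have "des_B n ?q = (if 1 \<in> N then 1 else 0) + card ?D1 + card ?D2"
    unfolding des_B_def by simp
  \<comment> \<open>The value at \<open>1\<close> is negative exactly when \<open>1\<close> lies in
    \<open>N\<close>; then \<open>des_B\<close> is at least 1, so subtracting 1 from its double does
    not truncate.\<close>
  then have fd: "fdes n ?q = (if 1 \<in> N then 1 else 0) + 2 * card ?D1 + 2 * card ?D2"
    unfolding fdes_def using q1 s1 by auto
  have "(\<Sum>i\<in>N. if i = 1 then 1 else if \<sigma> (i - 1) < \<sigma> i then 2 else 0) =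
      (\<Sum>i\<in>N. (if i = 1 then 1 else 0) + 2 * (if i \<noteq> 1 \<and> \<sigma> (i - 1) < \<sigma> i then 1 else (0::nat)))"
    by (rule sum.cong) auto
  also have "\<dots> = (if 1 \<in> N then 1 else 0) + 2 * card ?D1"
    using fin by (simp add: sum.distrib sum_distrib_left[symmetric] sum.If_cases Int_def)
  finally have s1: "(\<Sum>i\<in>N. if i = 1 then 1 else if \<sigma> (i - 1) < \<sigma> i then 2 else 0) =
    (if 1 \<in> N then 1 else 0) + 2 * card ?D1" .
  have s2: "(\<Sum>i\<in>{1..n} - N. if i < n \<and> \<sigma> (i + 1) < \<sigma> i then 2 else 0) = 2 * card ?D2"
    by (simp add: sum.If_cases Int_def)
  show ?thesis unfolding fd s1 s2 by simp
qed

section \<open>Summation over all signs\<close>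

text \<open>Both exponents are sums of contributions of single positions, so the sum over
  \<open>N\<close> is the expansion of a product of binomials: the first term is chosen at negative
  positions, the second at positive ones.\<close>

lemma sum_signs_eq_prod:
  fixes y t :: "'a::comm_semiring_1"
  assumes "n \<ge> 1" and \<sigma>: "\<sigma> permutes {1..n}"
  shows "(\<Sum>N\<in>Pow {1..n}. y ^ neg n (apply_signs \<sigma> N) * t ^ fdes n (apply_signs \<sigma> N)) =
    (\<Prod>i\<in>{1..n}. y * (if i = 1 then t else if \<sigma> (i - 1) < \<sigma> i then t ^ 2 else 1) +
      (if i < n \<and> \<sigma> (i + 1) < \<sigma> i then t ^ 2 else 1))"
proof -
  have "y ^ neg n (apply_signs \<sigma> N) * t ^ fdes n (apply_signs \<sigma> N) =
      (\<Prod>i\<in>N. y * (if i = 1 then t else if \<sigma> (i - 1) < \<sigma> i then t ^ 2 else 1)) *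
      (\<Prod>i\<in>{1..n} - N. if i < n \<and> \<sigma> (i + 1) < \<sigma> i then t ^ 2 else 1)"
    if N: "N \<subseteq> {1..n}" for N
    unfolding neg_apply_signs[OF \<sigma> N] fdes_apply_signs[OF assms(1) \<sigma> N] power_add power_sum
    by (simp add: prod.distrib mult.assoc if_distrib[of "power t"] cong: if_cong)
  then show ?thesis
    by (subst prod_add) (auto intro!: sum.cong)
qed

section \<open>Passage to the reverse-complement\<close>

text \<open>Extended by the identity so that it permutes \<open>{1..n}\<close>; conjugation by it is
  the reverse-complement.\<close>

definition rev_index :: "nat \<Rightarrow> nat \<Rightarrow> nat" where
  "rev_index n i = (if i \<in> {1..n} then n + 1 - i else i)"

lemma rev_index_rev_index [simp]: "rev_index n (rev_index n i) = i"
  by (auto simp: rev_index_def)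

lemma rev_index_permutes: "rev_index n permutes {1..n}"
proof (rule inj_imp_permutes)
  show "inj_on (rev_index n) {1..n}"
    by (metis inj_onI rev_index_rev_index)
qed (auto simp: rev_index_def)

lemma sum_sym_perms_reverse_complement:
  "(\<Sum>\<sigma>\<in>sym_perms n. g \<sigma>) = (\<Sum>p\<in>sym_perms n. g (rev_index n \<circ> p \<circ> rev_index n))"
proof (rule sum.reindex_bij_witness)
  fix p assume p: "p \<in> sym_perms n"
  show "rev_index n \<circ> p \<circ> rev_index n \<in> sym_perms n"
    using p rev_index_permutes by (auto simp: sym_perms_def intro!: permutes_compose)
  then show "rev_index n \<circ> p \<circ> rev_index n \<in> sym_perms n" .
qed (simp_all add: comp_def)

text \<open>The sum over signs has its exceptional factor \<open>t\<close> at position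
  \<open>1\<close>. The reverse-complement keeps ascents and descents but reverses their order,
  which moves this factor to position \<open>n\<close>, where the induction appends entries. Valleys
  become peaks, and a final descent becomes an initial one, hence a left peak.\<close>

lemma F_neg_fdes_eq_sum_prod:
  fixes y t :: "'a::comm_semiring_1"
  assumes "n \<ge> 1"
  shows "F_neg_fdes n y t = (\<Sum>p\<in>sym_perms n.
    \<Prod>i\<in>{1..n}. (if 1 < i \<and> p i < p (i - 1) then t ^ 2 else 1) +
      y * (if i = n then t else if p i < p (i + 1) then t ^ 2 else 1))"
proof -
  let ?r = "rev_index n"
  have "F_neg_fdes n y t = (\<Sum>\<sigma>\<in>sym_perms n.
      \<Prod>i\<in>{1..n}. y * (if i = 1 then t else if \<sigma> (i - 1) < \<sigma> i then t ^ 2 else 1) +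
        (if i < n \<and> \<sigma> (i + 1) < \<sigma> i then t ^ 2 else 1))"
    unfolding F_neg_fdes_def sum_signed_perms
    by (intro sum.cong refl sum_signs_eq_prod assms) (simp add: sym_perms_def)
  also have "\<dots> = (\<Sum>p\<in>sym_perms n.
      \<Prod>i\<in>{1..n}. y * (if i = 1 then t
          else if (?r \<circ> p \<circ> ?r) (i - 1) < (?r \<circ> p \<circ> ?r) i then t ^ 2 else 1) +
        (if i < n \<and> (?r \<circ> p \<circ> ?r) (i + 1) < (?r \<circ> p \<circ> ?r) i then t ^ 2 else 1))"
    by (rule sum_sym_perms_reverse_complement)
  also have "\<dots> = (\<Sum>p\<in>sym_perms n.
    \<Prod>i\<in>{1..n}. (if 1 < i \<and> p i < p (i - 1) then t ^ 2 else 1) +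
      y * (if i = n then t else if p i < p (i + 1) then t ^ 2 else 1))"
  proof (rule sum.cong[OF refl])
    fix p assume "p \<in> sym_perms n"
    then have p: "p permutes {1..n}" by (simp add: sym_perms_def)
    have less: "(?r \<circ> p \<circ> ?r) i < (?r \<circ> p \<circ> ?r) j \<longleftrightarrow> p (n + 1 - j) < p (n + 1 - i)"
      if "i \<in> {1..n}" "j \<in> {1..n}" for i j
    proof -
      have "p (n + 1 - i) \<in> {1..n}" "p (n + 1 - j) \<in> {1..n}"
        using that by (simp_all only: permutes_in_image[OF p]) auto
      moreover from this have "(?r \<circ> p \<circ> ?r) i = n + 1 - p (n + 1 - i)"
        "(?r \<circ> p \<circ> ?r) j = n + 1 - p (n + 1 - j)"
        using that by (simp_all only: comp_def rev_index_def if_True)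
      ultimately show ?thesis
        unfolding atLeastAtMost_iff by linarith
    qed
    show "(\<Prod>i\<in>{1..n}. y * (if i = 1 then t
          else if (?r \<circ> p \<circ> ?r) (i - 1) < (?r \<circ> p \<circ> ?r) i then t ^ 2 else 1) +
        (if i < n \<and> (?r \<circ> p \<circ> ?r) (i + 1) < (?r \<circ> p \<circ> ?r) i then t ^ 2 else 1)) =
      (\<Prod>i\<in>{1..n}. (if 1 < i \<and> p i < p (i - 1) then t ^ 2 else 1) +
        y * (if i = n then t else if p i < p (i + 1) then t ^ 2 else 1))"
    \<comment> \<open>Reflecting the index exchanges left and right neighbours (\<open>e1\<close>)
      and the two ends (\<open>e2\<close>).\<close>
    proof (rule prod.reindex_bij_witness[of _ "\<lambda>i. n + 1 - i" "\<lambda>i. n + 1 - i"])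
      fix i assume i: "i \<in> {1..n}"
      have e1: "n + 1 - (i - 1) = n + 1 - i + 1" "n + 1 - (i + 1) = n + 1 - i - 1"
        using i by auto
      have e2: "n + 1 - i = n \<longleftrightarrow> i = 1" "1 < n + 1 - i \<longleftrightarrow> i < n"
        using i by auto
      have "i \<noteq> 1 \<Longrightarrow> (?r \<circ> p \<circ> ?r) (i - 1) < (?r \<circ> p \<circ> ?r) i \<longleftrightarrow>
          p (n + 1 - i) < p (n + 1 - i + 1)"
        using i by (intro less[of "i - 1" i, unfolded e1]) auto
      moreover have "i < n \<Longrightarrow> (?r \<circ> p \<circ> ?r) (i + 1) < (?r \<circ> p \<circ> ?r) i \<longleftrightarrow>
          p (n + 1 - i) < p (n + 1 - i - 1)"
        using i by (intro less[of "i + 1" i, unfolded e1]) auto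
      ultimately show "(if 1 < n + 1 - i \<and> p (n + 1 - i) < p (n + 1 - i - 1) then t ^ 2 else 1) +
          y * (if n + 1 - i = n then t
            else if p (n + 1 - i) < p (n + 1 - i + 1) then t ^ 2 else 1) =
        y * (if i = 1 then t
          else if (?r \<circ> p \<circ> ?r) (i - 1) < (?r \<circ> p \<circ> ?r) i then t ^ 2 else 1) +
        (if i < n \<and> (?r \<circ> p \<circ> ?r) (i + 1) < (?r \<circ> p \<circ> ?r) i then t ^ 2 else 1)"
        unfolding e2 by (simp only: add.commute not_False_eq_True simp_thms cong: if_cong conj_cong)
    qed auto
  qed
  finally show ?thesis .
qed

section \<open>Specialisation to the indeterminates\<close>

text \<open>Each expression is the image under \<open>to_fract\<close> of a polynomial with a
  nonzero coefficient, and \<open>to_fract\<close> sends only \<open>0\<close> to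
  \<open>0\<close>.\<close>

lemma indets_nonzero:
  "indet_t \<noteq> 0" "indet_y + indet_t \<noteq> 0" "indet_y + indet_t ^ 2 \<noteq> 0"
  "1 + indet_y * indet_t \<noteq> 0" "1 + indet_y * indet_t ^ 2 \<noteq> 0"
  unfolding indet_y_def indet_t_def power2_eq_square to_fract_1[symmetric]
    to_fract_mult[symmetric] to_fract_add[symmetric] to_fract_eq_0_iff
  by (simp_all add: one_pCons)

theorem theorem4p17:
  fixes n :: nat and y t :: ratfun2
  defines "y \<equiv> indet_y" and "t \<equiv> indet_t"
  assumes "n \<ge> 1"
  shows "F_neg_fdes n y t =
    (1 + y * t) * (1 + y * t ^ 2) ^ (n - 1) *
    P_lpk_val_des n
      ((t * (1 + y) * (y + t)) / ((y + t ^ 2) * (1 + y * t)))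
      ((t * (1 + y) * (1 + y * t)) / ((1 + y * t ^ 2) * (y + t)))
      ((y + t ^ 2) / (1 + y * t ^ 2))"
  unfolding F_neg_fdes_eq_sum_prod[OF assms(3)] P_lpk_val_des_def sum_distrib_left
\<comment> \<open>Both sides are now sums over \<open>sym_perms n\<close>, and they agree term by
  term.\<close>
proof (rule sum.cong[OF refl])
  fix p assume "p \<in> sym_perms n"
  then have "inj p" by (auto simp: sym_perms_def permutes_inj)
  then have "p i \<noteq> p (i + 1)" for i by (simp add: inj_eq)
  then show "(\<Prod>i\<in>{1..n}. (if 1 < i \<and> p i < p (i - 1) then t ^ 2 else 1) +
        y * (if i = n then t else if p i < p (i + 1) then t ^ 2 else 1)) =
    (1 + y * t) * (1 + y * t ^ 2) ^ (n - 1) *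
    (((t * (1 + y) * (y + t)) / ((y + t ^ 2) * (1 + y * t))) ^ lpk n p *
     ((t * (1 + y) * (1 + y * t)) / ((1 + y * t ^ 2) * (y + t))) ^ val n p *
     ((y + t ^ 2) / (1 + y * t ^ 2)) ^ des n p)"
    using indets_nonzero assms(3) unfolding y_def t_def by (intro prod_weights_eq_statistics)
qed

end
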